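(* Assume that $\nu:=\frac{2\kappa\lambda}{\theta^2}>\frac12$ and let $f\colon\mathbb{R}\to\mathbb{R}$ be a (Borel measurable) function such that $$\sup_{x\in\mathbb{R}}|f(x)\exp(-x)|<\infty.$$ If $\rho<0$, then there exists $\varepsilon>0$ such that $$\limsup_{\Delta\to0}E|f(x_N)|^{1+\varepsilon}<\infty,$$ where $x_N$ is the terminal value of the discretization scheme defined in the context.
   Context: Let $T>0$, $x_0\in\mathbb{R}$, $v_0,\kappa,\lambda,\theta>0$, $\mu\in\mathbb{R}$, $\rho\in[-1,1]$, and let $W,B$ be independent standard Brownian motions. For a discretization $0=t_0<t_1<\dots<t_N=T$ of $[0,T]$ put $\Delta_nW=W_{t_{n+1}}-W_{t_n}$, $\Delta_nB=B_{t_{n+1}}-B_{t_n}$ and $\Delta=\max_{k=1,\dots,N}|t_k-t_{k-1}|$. The scheme (a discretization of the log-Heston model) starts at the given values $x_0,v_0$ and is defined for $n=0,\dots,N-1$ by $$x_{n+1}=x_n+\big(\mu-\tfrac12v_n\big)(t_{n+1}-t_n)+\sqrt{v_n}\big(\rho\Delta_nW+\sqrt{1-\rho^2}\Delta_nB\big),$$ $$v_{n+1}=v_n+\kappa(\lambda-v_{n+1})(t_{n+1}-t_n)+\theta\sqrt{v_n}\Delta_nW+\tfrac{\theta^2}{4}\big((\Delta_nW)^2-(t_{n+1}-t_n)\big).$$ The recursion for $v$ is implicit and linear in $v_{n+1}$; solving it gives $v_{n+1}=\frac{1}{1+\kappa(t_{n+1}-t_n)}\big((\sqrt{v_n}+\frac{\theta}{2}\Delta_nW)^2+(\kappa\lambda-\frac{\theta^2}{4})(t_{n+1}-t_n)\big)$,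 so the scheme is well defined with $v_n\ge0$ when $4\kappa\lambda/\theta^2\ge1$. The limsup $\Delta\to0$ is over arbitrary (not necessarily equidistant) discretizations of $[0,T]$ whose maximal step size $\Delta$ tends to zero. *)

theory Defs
  imports "HOL-Probability.Probability"
begin

definition (in prob_space) standard_brownian_motion :: "(real \<Rightarrow> 'a \<Rightarrow> real) \<Rightarrow> bool" where
  "standard_brownian_motion W \<longleftrightarrow>
     (\<forall>t\<ge>0. random_variable borel (W t)) \<and>
     (AE \<omega> in M. W 0 \<omega> = 0) \<and>
     (\<forall>(t :: nat \<Rightarrow> real) m. 0 \<le> t 0 \<and> (\<forall>i<m. t i < t (Suc i)) \<longrightarrow>
        indep_vars (\<lambda>_. borel) (\<lambda>i \<omega>. W (t (Suc i)) \<omega> - W (t i) \<omega>) {..<m}) \<and>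
     (\<forall>s t. 0 \<le> s \<and> s < t \<longrightarrow>
        distributed M lborel (\<lambda>\<omega>. W t \<omega> - W s \<omega>) (normal_density 0 (sqrt (t - s)))) \<and>
     (AE \<omega> in M. continuous_on {0..} (\<lambda>t. W t \<omega>))"

text \<open>Independence of the two processes as a whole, i.e. of the sigma-algebras they generate.\<close>

definition (in prob_space) indep_processes ::
  "(real \<Rightarrow> 'a \<Rightarrow> real) \<Rightarrow> (real \<Rightarrow> 'a \<Rightarrow> real) \<Rightarrow> bool" where
  "indep_processes W B \<longleftrightarrow>
     indep_var (PiM {0..} (\<lambda>_. borel)) (\<lambda>\<omega>. \<lambda>t\<in>{0..}. W t \<omega>)
               (PiM {0..} (\<lambda>_. borel)) (\<lambda>\<omega>. \<lambda>t\<in>{0..}. B t \<omega>)"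

text \<open>A discretization is a pair \<open>(N, t)\<close>; the values \<open>t n\<close> for \<open>n > N\<close> are irrelevant.\<close>

definition discretizations :: "real \<Rightarrow> (nat \<times> (nat \<Rightarrow> real)) set" where
  "discretizations T = {(N, t). t 0 = 0 \<and> (\<forall>n<N. t n < t (Suc n)) \<and> t N = T}"

definition mesh :: "nat \<times> (nat \<Rightarrow> real) \<Rightarrow> real" where
  "mesh = (\<lambda>(N, t). MAX k\<in>{1..N}. \<bar>t k - t (k - 1)\<bar>)"

definition mesh_to_0 :: "real \<Rightarrow> (nat \<times> (nat \<Rightarrow> real)) filter" where
  "mesh_to_0 T = inf (filtercomap mesh (at_right 0)) (principal (discretizations T))"

text \<open>
  The scheme along fixed driving paths \<open>w\<close> and \<open>b\<close>. The recursion for \<open>v\<close> is implicit;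
  the value \<open>y\<close> selected by \<open>THE\<close> exists and is unique if \<open>\<kappa> > 0\<close> and \<open>t\<close> is
  increasing, see \<open>implicit_step_unique\<close> and \<open>heston_v_implicit\<close> below.
\<close>

primrec heston_v ::
  "real \<Rightarrow> real \<Rightarrow> real \<Rightarrow> real \<Rightarrow> (nat \<Rightarrow> real) \<Rightarrow> (real \<Rightarrow> real) \<Rightarrow> nat \<Rightarrow> real" where
  "heston_v \<kappa> lam \<theta> v\<^sub>0 t w 0 = v\<^sub>0"
| "heston_v \<kappa> lam \<theta> v\<^sub>0 t w (Suc n) =
     (THE y. y = heston_v \<kappa> lam \<theta> v\<^sub>0 t w n + \<kappa> * (lam - y) * (t (Suc n) - t n)
                 + \<theta> * sqrt (heston_v \<kappa> lam \<theta> v\<^sub>0 t w n) * (w (t (Suc n)) - w (t n))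
                 + \<theta>\<^sup>2 / 4 * ((w (t (Suc n)) - w (t n))\<^sup>2 - (t (Suc n) - t n)))"

primrec heston_x ::
  "real \<Rightarrow> real \<Rightarrow> real \<Rightarrow> real \<Rightarrow> real \<Rightarrow> real \<Rightarrow> real \<Rightarrow>
   (nat \<Rightarrow> real) \<Rightarrow> (real \<Rightarrow> real) \<Rightarrow> (real \<Rightarrow> real) \<Rightarrow> nat \<Rightarrow> real" where
  "heston_x \<mu> \<kappa> lam \<theta> \<rho> x\<^sub>0 v\<^sub>0 t w b 0 = x\<^sub>0"
| "heston_x \<mu> \<kappa> lam \<theta> \<rho> x\<^sub>0 v\<^sub>0 t w b (Suc n) =
     heston_x \<mu> \<kappa> lam \<theta> \<rho> x\<^sub>0 v\<^sub>0 t w b n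
     + (\<mu> - 1 / 2 * heston_v \<kappa> lam \<theta> v\<^sub>0 t w n) * (t (Suc n) - t n)
     + sqrt (heston_v \<kappa> lam \<theta> v\<^sub>0 t w n)
       * (\<rho> * (w (t (Suc n)) - w (t n)) + sqrt (1 - \<rho>\<^sup>2) * (b (t (Suc n)) - b (t n)))"

lemma implicit_step_unique:
  fixes \<kappa> lam h a y :: real
  assumes "\<kappa> > 0" "h \<ge> 0"
  shows "y = a + \<kappa> * (lam - y) * h + c + d \<longleftrightarrow> y = (a + \<kappa> * lam * h + c + d) / (1 + \<kappa> * h)"
proof -
  have "1 + \<kappa> * h > 0"
    using assms by (simp add: add_pos_nonneg)
  then show ?thesis
    by (auto simp: field_simps)
qed

lemma heston_v_implicit:
  assumes "\<kappa> > 0" "t n < t (Suc n)"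
  shows "heston_v \<kappa> lam \<theta> v\<^sub>0 t w (Suc n) =
     heston_v \<kappa> lam \<theta> v\<^sub>0 t w n
     + \<kappa> * (lam - heston_v \<kappa> lam \<theta> v\<^sub>0 t w (Suc n)) * (t (Suc n) - t n)
     + \<theta> * sqrt (heston_v \<kappa> lam \<theta> v\<^sub>0 t w n) * (w (t (Suc n)) - w (t n))
     + \<theta>\<^sup>2 / 4 * ((w (t (Suc n)) - w (t n))\<^sup>2 - (t (Suc n) - t n))"
  unfolding heston_v.simps
  by (rule theI', subst implicit_step_unique) (use assms in auto)

lemma heston_v_Suc:
  assumes "\<kappa> > 0" "t n < t (Suc n)" "heston_v \<kappa> lam \<theta> v\<^sub>0 t w n \<ge> 0"
  shows "heston_v \<kappa> lam \<theta> v\<^sub>0 t w (Suc n) =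
     ((sqrt (heston_v \<kappa> lam \<theta> v\<^sub>0 t w n) + \<theta> / 2 * (w (t (Suc n)) - w (t n)))\<^sup>2
      + (\<kappa> * lam - \<theta>\<^sup>2 / 4) * (t (Suc n) - t n)) / (1 + \<kappa> * (t (Suc n) - t n))"
proof -
  define u where "u = heston_v \<kappa> lam \<theta> v\<^sub>0 t w n"
  define h where "h = t (Suc n) - t n"
  define d where "d = w (t (Suc n)) - w (t n)"
  have "(sqrt u)\<^sup>2 = u"
    using assms(3) by (simp add: u_def)
  then have "u + \<kappa> * lam * h + \<theta> * sqrt u * d + \<theta>\<^sup>2 / 4 * (d\<^sup>2 - h)
      = (sqrt u + \<theta> / 2 * d)\<^sup>2 + (\<kappa> * lam - \<theta>\<^sup>2 / 4) * h"
    by (simp add: power2_sum power_mult_distrib power_divide field_simps)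
  moreover have "heston_v \<kappa> lam \<theta> v\<^sub>0 t w (Suc n) =
     (u + \<kappa> * lam * h + \<theta> * sqrt u * d + \<theta>\<^sup>2 / 4 * (d\<^sup>2 - h)) / (1 + \<kappa> * h)"
    using iffD1[OF implicit_step_unique[OF assms(1)] heston_v_implicit[OF assms(1,2)]] assms(2)
    by (simp only: u_def h_def d_def)
  ultimately show ?thesis
    by (simp add: u_def h_def d_def)
qed

lemma mesh_pos:
  assumes "T > 0" "d \<in> discretizations T"
  shows "mesh d > 0"
proof -
  obtain N t where d: "d = (N, t)" by (cases d)
  have t: "t 0 = 0" "\<And>n. n < N \<Longrightarrow> t n < t (Suc n)" "t N = T"
    using assms(2) by (auto simp: d discretizations_def)
  have N: "N \<ge> 1"
    using t assms(1) by (cases N) auto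
  have "0 < \<bar>t 1 - t (1 - 1)\<bar>"
    using t(2)[of 0] N by auto
  also have "\<dots> \<le> (MAX k\<in>{1..N}. \<bar>t k - t (k - 1)\<bar>)"
    using N by (intro Max_ge finite_imageI imageI) auto
  finally show ?thesis
    by (simp add: d mesh_def)
qed

lemma eventually_mesh_to_0:
  assumes "T > 0"
  shows "eventually P (mesh_to_0 T) \<longleftrightarrow>
    (\<exists>\<delta>>0. \<forall>d\<in>discretizations T. mesh d < \<delta> \<longrightarrow> P d)"
proof
  assume "eventually P (mesh_to_0 T)"
  then obtain Q where Q: "eventually Q (at_right (0::real))"
    and P: "\<And>d. Q (mesh d) \<Longrightarrow> d \<in> discretizations T \<Longrightarrow> P d"
    by (auto simp: mesh_to_0_def eventually_inf_principal eventually_filtercomap)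
  from Q obtain \<delta> where "\<delta> > 0" "\<And>y. y > 0 \<Longrightarrow> y < \<delta> \<Longrightarrow> Q y"
    unfolding eventually_at_right_field by auto
  then show "\<exists>\<delta>>0. \<forall>d\<in>discretizations T. mesh d < \<delta> \<longrightarrow> P d"
    using P mesh_pos[OF assms] by blast
next
  assume "\<exists>\<delta>>0. \<forall>d\<in>discretizations T. mesh d < \<delta> \<longrightarrow> P d"
  then obtain \<delta> where \<delta>: "\<delta> > 0" "\<And>d. d \<in> discretizations T \<Longrightarrow> mesh d < \<delta> \<Longrightarrow> P d"
    by blast
  have "eventually (\<lambda>y. y < \<delta>) (at_right (0::real))"
    using \<delta>(1) unfolding eventually_at_right_field by auto
  then show "eventually P (mesh_to_0 T)"
    using \<delta>(2) by (auto simp: mesh_to_0_def eventually_inf_principal eventually_filtercomap)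
qed

lemma mesh_to_0_nontrivial:
  assumes "T > 0"
  shows "mesh_to_0 T \<noteq> bot"
proof
  assume "mesh_to_0 T = bot"
  then have "eventually (\<lambda>_. False) (mesh_to_0 T)"
    by simp
  then obtain \<delta> where \<delta>: "\<delta> > 0" "\<And>d. d \<in> discretizations T \<Longrightarrow> \<not> mesh d < \<delta>"
    unfolding eventually_mesh_to_0[OF assms] by blast
  obtain N :: nat where N: "N > 0" "T / real N < \<delta>"
  proof -
    obtain m :: nat where m: "T / \<delta> < real m"
      using reals_Archimedean2 by blast
    have "m > 0"
      using m assms \<delta>(1) by (cases m) (auto simp: field_simps)
    then show ?thesis
      using that[of m] m \<delta>(1) by (auto simp: field_simps)
  qed
  define t where "t = (\<lambda>n. T * real n / real N)"
  have "(N, t) \<in> discretizations T"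
    using N assms by (auto simp: discretizations_def t_def field_simps)
  moreover have "mesh (N, t) < \<delta>"
  proof -
    have "\<bar>t k - t (k - 1)\<bar> < \<delta>" if "k \<in> {1..N}" for k
    proof -
      have "t k - t (k - 1) = T / real N"
        using that N by (simp add: t_def of_nat_diff field_simps)
      then show ?thesis
        using N assms by simp
    qed
    then show ?thesis
      using N by (simp add: mesh_def)
  qed
  ultimately show False
    using \<delta>(2) by blast
qed

end

theory Submission
  imports Defs
begin

text \<open>
  Put \<open>p = 1 + \<rho>\<^sup>2\<close>, so that \<open>p * (1 - \<rho>\<^sup>2) \<le> 1\<close>. Integrating out \<open>B\<close> turns the \<open>B\<close>-part of
  \<open>exp (p * x\<^sub>N)\<close> into \<open>exp (p\<^sup>2 * (1 - \<rho>\<^sup>2) / 2 * (\<Sum>n. v\<^sub>n * h\<^sub>n))\<close>, which the Ito correction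
  \<open>- p / 2 * (\<Sum>n. v\<^sub>n * h\<^sub>n)\<close> absorbs. What remains is \<open>exp (p * \<rho> * (\<Sum>n. sqrt v\<^sub>n * \<Delta>\<^sub>nW))\<close>.
  The recursion for \<open>v\<close> and \<open>v \<ge> 0\<close> give, path by path,
  \<open>\<theta> * (\<Sum>n. sqrt v\<^sub>n * \<Delta>\<^sub>nW) \<ge> - v\<^sub>0 - \<kappa> * \<lambda> * T - \<theta>\<^sup>2 / 4 * (\<Sum>n. (\<Delta>\<^sub>nW)\<^sup>2)\<close>. As \<open>\<rho> < 0\<close>, this
  leaves an exponential moment of \<open>\<Sum>n. (\<Delta>\<^sub>nW)\<^sup>2\<close> to be bounded, which is a product of
  Gaussian integrals.
\<close>

section \<open>Gaussian exponential moments\<close>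

text \<open>Completing the square: tilting the centred density by \<open>exp (a * x)\<close> moves
  its mean to \<open>a * \<sigma>\<^sup>2\<close>, and the constant left over is the moment.\<close>

lemma (in prob_space) nn_integral_exp_normal:
  assumes X: "distributed M lborel X (normal_density 0 \<sigma>)" and \<sigma>: "\<sigma> > 0"
  shows "(\<integral>\<^sup>+\<omega>. ennreal (exp (a * X \<omega>)) \<partial>M) = ennreal (exp (a\<^sup>2 * \<sigma>\<^sup>2 / 2))"
proof -
  have *: "normal_density 0 \<sigma> x * exp (a * x)
      = exp (a\<^sup>2 * \<sigma>\<^sup>2 / 2) * normal_density (a * \<sigma>\<^sup>2) \<sigma> x" for x
  proof -
    have "- (x - 0)\<^sup>2 / (2 * \<sigma>\<^sup>2) + a * x
        = a\<^sup>2 * \<sigma>\<^sup>2 / 2 + - (x - a * \<sigma>\<^sup>2)\<^sup>2 / (2 * \<sigma>\<^sup>2)"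
      using \<sigma> by (simp add: field_simps power2_eq_square)
    then show ?thesis
      unfolding normal_density_def by (simp add: exp_add[symmetric])
  qed
  have "(\<integral>\<^sup>+\<omega>. ennreal (exp (a * X \<omega>)) \<partial>M)
      = (\<integral>\<^sup>+x. ennreal (normal_density 0 \<sigma> x) * ennreal (exp (a * x)) \<partial>lborel)"
    by (rule distributed_nn_integral[OF X, symmetric]) simp
  also have "\<dots> = (\<integral>\<^sup>+x. ennreal (exp (a\<^sup>2 * \<sigma>\<^sup>2 / 2)) * ennreal (normal_density (a * \<sigma>\<^sup>2) \<sigma> x) \<partial>lborel)"
    by (simp add: ennreal_mult'[symmetric] * normal_density_nonneg)
  also have "\<dots> = ennreal (exp (a\<^sup>2 * \<sigma>\<^sup>2 / 2)) * (\<integral>\<^sup>+x. ennreal (normal_density (a * \<sigma>\<^sup>2) \<sigma> x) \<partial>lborel)"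
    by (rule nn_integral_cmult) simp
  also have "(\<integral>\<^sup>+x. ennreal (normal_density (a * \<sigma>\<^sup>2) \<sigma> x) \<partial>lborel) = 1"
    using integral_normal_density[OF \<sigma>] integrable_normal_density[OF \<sigma>]
    by (subst nn_integral_eq_integral) auto
  finally show ?thesis
    by simp
qed

text \<open>Tilting by \<open>exp (c * x\<^sup>2)\<close> gives a multiple of the centred Gaussian
  density with standard deviation \<open>\<sigma> / r\<close>; the factor \<open>1 / r\<close> is
  the ratio of the two normalizing constants. The bound on \<open>c\<close> keeps the tilted
  exponent negative.\<close>

lemma (in prob_space) nn_integral_exp_normal_square:
  assumes X: "distributed M lborel X (normal_density 0 \<sigma>)" and \<sigma>: "\<sigma> > 0"
    and c: "2 * c * \<sigma>\<^sup>2 < 1"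
  shows "(\<integral>\<^sup>+\<omega>. ennreal (exp (c * (X \<omega>)\<^sup>2)) \<partial>M) = ennreal (1 / sqrt (1 - 2 * c * \<sigma>\<^sup>2))"
proof -
  define r where "r = sqrt (1 - 2 * c * \<sigma>\<^sup>2)"
  have r: "r > 0" "r\<^sup>2 = 1 - 2 * c * \<sigma>\<^sup>2"
    using c by (auto simp: r_def)
  have \<sigma>r: "\<sigma> / r > 0"
    using r \<sigma> by simp
  have *: "normal_density 0 \<sigma> x * exp (c * x\<^sup>2) = 1 / r * normal_density 0 (\<sigma> / r) x" for x
  proof -
    have "- (x - 0)\<^sup>2 / (2 * \<sigma>\<^sup>2) + c * x\<^sup>2 = - (x\<^sup>2 * (1 - 2 * c * \<sigma>\<^sup>2)) / (2 * \<sigma>\<^sup>2)"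
      using \<sigma> by (simp add: field_simps)
    also have "\<dots> = - (x - 0)\<^sup>2 / (2 * (\<sigma> / r)\<^sup>2)"
      by (simp add: power_divide flip: r(2))
    finally have "exp (- (x - 0)\<^sup>2 / (2 * \<sigma>\<^sup>2)) * exp (c * x\<^sup>2) = exp (- (x - 0)\<^sup>2 / (2 * (\<sigma> / r)\<^sup>2))"
      by (simp add: exp_add[symmetric])
    moreover have "1 / sqrt (2 * pi * \<sigma>\<^sup>2) = 1 / r * (1 / sqrt (2 * pi * (\<sigma> / r)\<^sup>2))"
      using r(1) \<sigma> by (simp add: real_sqrt_mult real_sqrt_divide power_divide)
    ultimately show ?thesis
      unfolding normal_density_def by (simp only: mult.assoc)
  qed
  have "(\<integral>\<^sup>+\<omega>. ennreal (exp (c * (X \<omega>)\<^sup>2)) \<partial>M)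
      = (\<integral>\<^sup>+x. ennreal (normal_density 0 \<sigma> x) * ennreal (exp (c * x\<^sup>2)) \<partial>lborel)"
    by (rule distributed_nn_integral[OF X, symmetric]) simp
  also have "\<dots> = (\<integral>\<^sup>+x. ennreal (1 / r) * ennreal (normal_density 0 (\<sigma> / r) x) \<partial>lborel)"
    using r(1) by (simp only: ennreal_mult'[symmetric] * normal_density_nonneg) (simp add: ennreal_mult'[symmetric])
  also have "\<dots> = ennreal (1 / r) * (\<integral>\<^sup>+x. ennreal (normal_density 0 (\<sigma> / r) x) \<partial>lborel)"
    by (rule nn_integral_cmult) simp
  also have "(\<integral>\<^sup>+x. ennreal (normal_density 0 (\<sigma> / r) x) \<partial>lborel) = 1"
    using integral_normal_density[OF \<sigma>r] integrable_normal_density[OF \<sigma>r]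
    by (subst nn_integral_eq_integral) auto
  finally show ?thesis
    by (simp add: r_def)
qed

text \<open>Makes each Gaussian factor exponential in its step size, so that a product over any
  number of steps stays bounded. The proof squares the claim:
  \<open>1 \<le> (1 - x) * (1 + 2 * x)\<close> on this range, and
  \<open>1 + 2 * x \<le> exp (2 * x)\<close>.\<close>

lemma inverse_sqrt_one_minus_le_exp:
  fixes x :: real
  assumes "0 \<le> x" "x \<le> 1 / 2"
  shows "1 / sqrt (1 - x) \<le> exp x"
proof -
  have "1 \<le> (1 - x) * (1 + 2 * x)"
  proof -
    have "0 \<le> x * (1 - 2 * x)"
      using assms by simp
    then show ?thesis
      by (simp add: algebra_simps)
  qed
  also have "\<dots> \<le> (1 - x) * exp (2 * x)"
    using assms by (intro mult_left_mono exp_ge_add_one_self) auto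
  also have "\<dots> = (sqrt (1 - x) * exp x)\<^sup>2"
    using assms by (simp add: power_mult_distrib exp_double)
  finally have "1 \<le> sqrt (1 - x) * exp x"
    using assms by (intro power2_le_imp_le[of 1]) auto
  then show ?thesis
    using assms by (simp add: field_simps)
qed

section \<open>Brownian increments along a discretization\<close>

lemma discretizations_nonneg:
  assumes "(N, t) \<in> discretizations T" "n \<le> N"
  shows "t n \<ge> 0"
  using assms(2)
proof (induction n)
  case 0
  then show ?case using assms(1) by (simp add: discretizations_def)
next
  case (Suc n)
  then have "t n < t (Suc n)" using assms(1) by (auto simp: discretizations_def)
  then show ?case using Suc by simp
qed

lemma step_le_mesh:
  assumes "n < N"
  shows "t (Suc n) - t n \<le> mesh (N, t)"
proof -
  have "t (Suc n) - t n \<le> \<bar>t (Suc n) - t (Suc n - 1)\<bar>"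
    by simp
  also have "\<dots> \<le> (MAX k\<in>{1..N}. \<bar>t k - t (k - 1)\<bar>)"
    using assms by (intro Max_ge finite_imageI imageI) auto
  finally show ?thesis
    by (simp add: mesh_def)
qed

lemma (in prob_space) nn_integral_prod_increments:
  assumes W: "standard_brownian_motion W" and d: "(N, t) \<in> discretizations T"
    and g: "\<And>n. g n \<in> borel_measurable borel"
  shows "(\<integral>\<^sup>+\<omega>. (\<Prod>n<N. g n (W (t (Suc n)) \<omega> - W (t n) \<omega>)) \<partial>M)
    = (\<Prod>n<N. \<integral>\<^sup>+\<omega>. g n (W (t (Suc n)) \<omega> - W (t n) \<omega>) \<partial>M)"
proof (rule indep_vars_nn_integral)
  \<comment> \<open>The independence clause of Brownian motion constrains the times only up to the
    index \<open>m\<close>, so it applies with \<open>m = N\<close> although \<open>t\<close> is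
    arbitrary beyond \<open>N\<close>.\<close>
  have "indep_vars (\<lambda>_. borel) (\<lambda>i \<omega>. W (t (Suc i)) \<omega> - W (t i) \<omega>) {..<N}"
    using W d unfolding standard_brownian_motion_def discretizations_def by auto
  then show "indep_vars (\<lambda>_. borel) (\<lambda>n \<omega>. g n (W (t (Suc n)) \<omega> - W (t n) \<omega>)) {..<N}"
    by (rule indep_vars_compose2) (rule g)
qed auto

lemma (in prob_space) increment_normal:
  assumes W: "standard_brownian_motion W" and d: "(N, t) \<in> discretizations T" and n: "n < N"
  shows "distributed M lborel (\<lambda>\<omega>. W (t (Suc n)) \<omega> - W (t n) \<omega>)
    (normal_density 0 (sqrt (t (Suc n) - t n)))"
proof -
  have "t n < t (Suc n)"
    using d n by (auto simp: discretizations_def)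
  then show ?thesis
    using W discretizations_nonneg[OF d, of n] n unfolding standard_brownian_motion_def by auto
qed

text \<open>Applied to \<open>B\<close> once the path of \<open>W\<close> is frozen: the
  coefficients \<open>a n\<close> are then deterministic, and the exponential splits into
  independent factors.\<close>

lemma (in prob_space) nn_integral_exp_sum_increments:
  assumes W: "standard_brownian_motion W" and d: "(N, t) \<in> discretizations T"
  shows "(\<integral>\<^sup>+\<omega>. ennreal (exp (\<Sum>n<N. a n * (W (t (Suc n)) \<omega> - W (t n) \<omega>))) \<partial>M)
    = ennreal (exp (\<Sum>n<N. (a n)\<^sup>2 * (t (Suc n) - t n) / 2))"
proof -
  have pos: "t n < t (Suc n)" if "n < N" for n
    using d that by (auto simp: discretizations_def)
  have "(\<integral>\<^sup>+\<omega>. ennreal (exp (\<Sum>n<N. a n * (W (t (Suc n)) \<omega> - W (t n) \<omega>))) \<partial>M)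
      = (\<integral>\<^sup>+\<omega>. (\<Prod>n<N. ennreal (exp (a n * (W (t (Suc n)) \<omega> - W (t n) \<omega>)))) \<partial>M)"
    by (simp add: exp_sum prod_ennreal)
  also have "\<dots> = (\<Prod>n<N. \<integral>\<^sup>+\<omega>. ennreal (exp (a n * (W (t (Suc n)) \<omega> - W (t n) \<omega>))) \<partial>M)"
    by (rule nn_integral_prod_increments[OF W d, of "\<lambda>n x. ennreal (exp (a n * x))"]) simp
  also have "\<dots> = (\<Prod>n<N. ennreal (exp ((a n)\<^sup>2 * (t (Suc n) - t n) / 2)))"
  proof (rule prod.cong)
    fix n assume "n \<in> {..<N}"
    then show "(\<integral>\<^sup>+\<omega>. ennreal (exp (a n * (W (t (Suc n)) \<omega> - W (t n) \<omega>))) \<partial>M)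
        = ennreal (exp ((a n)\<^sup>2 * (t (Suc n) - t n) / 2))"
      using nn_integral_exp_normal[OF increment_normal[OF W d, of n], of "a n"] pos[of n] by simp
  qed simp
  finally show ?thesis
    by (simp add: exp_sum prod_ennreal)
qed

text \<open>By independence the moment is a product; each factor is at most
  \<open>exp (2 * c * h)\<close>, and the steps \<open>h\<close> add up to \<open>T\<close>. The
  discretization matters only through the smallness condition on its mesh.\<close>

lemma (in prob_space) nn_integral_exp_sum_squared_increments_le:
  assumes W: "standard_brownian_motion W" and d: "(N, t) \<in> discretizations T"
    and c: "c \<ge> 0" "4 * c * mesh (N, t) \<le> 1"
  shows "(\<integral>\<^sup>+\<omega>. ennreal (exp (\<Sum>n<N. c * (W (t (Suc n)) \<omega> - W (t n) \<omega>)\<^sup>2)) \<partial>M)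
    \<le> ennreal (exp (2 * c * T))"
proof -
  have pos: "t n < t (Suc n)" if "n < N" for n
    using d that by (auto simp: discretizations_def)
  have "(\<integral>\<^sup>+\<omega>. ennreal (exp (\<Sum>n<N. c * (W (t (Suc n)) \<omega> - W (t n) \<omega>)\<^sup>2)) \<partial>M)
      = (\<integral>\<^sup>+\<omega>. (\<Prod>n<N. ennreal (exp (c * (W (t (Suc n)) \<omega> - W (t n) \<omega>)\<^sup>2))) \<partial>M)"
    by (simp add: exp_sum prod_ennreal)
  also have "\<dots> = (\<Prod>n<N. \<integral>\<^sup>+\<omega>. ennreal (exp (c * (W (t (Suc n)) \<omega> - W (t n) \<omega>)\<^sup>2)) \<partial>M)"
    by (rule nn_integral_prod_increments[OF W d, of "\<lambda>n x. ennreal (exp (c * x\<^sup>2))"]) simp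
  also have "\<dots> \<le> (\<Prod>n<N. ennreal (exp (2 * c * (t (Suc n) - t n))))"
  proof (rule prod_mono_ennreal)
    fix n assume "n \<in> {..<N}"
    then have n: "n < N" by simp
    define h where "h = t (Suc n) - t n"
    have h: "h > 0" using pos[OF n] by (simp add: h_def)
    \<comment> \<open>The mesh condition gives \<open>2 * c * h \<le> 1 / 2\<close>, which makes the
      Gaussian integral finite and is the range of
      \<open>inverse_sqrt_one_minus_le_exp\<close>.\<close>
    have "c * h \<le> c * mesh (N, t)"
      using c(1) step_le_mesh[OF n] by (intro mult_left_mono) (auto simp: h_def)
    then have ch: "0 \<le> 2 * c * h" "2 * c * h \<le> 1 / 2"
      using c h by auto
    have "(\<integral>\<^sup>+\<omega>. ennreal (exp (c * (W (t (Suc n)) \<omega> - W (t n) \<omega>)\<^sup>2)) \<partial>M)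
        = ennreal (1 / sqrt (1 - 2 * c * h))"
      using nn_integral_exp_normal_square[OF increment_normal[OF W d n], of c] h ch
      by (simp add: h_def)
    also have "\<dots> \<le> ennreal (exp (2 * c * h))"
      by (intro ennreal_leI inverse_sqrt_one_minus_le_exp ch)
    finally show "(\<integral>\<^sup>+\<omega>. ennreal (exp (c * (W (t (Suc n)) \<omega> - W (t n) \<omega>)\<^sup>2)) \<partial>M)
        \<le> ennreal (exp (2 * c * (t (Suc n) - t n)))"
      by (simp add: h_def)
  qed
  also have "\<dots> = ennreal (exp (\<Sum>n<N. 2 * c * (t (Suc n) - t n)))"
    by (simp add: exp_sum prod_ennreal)
  also have "(\<Sum>n<N. 2 * c * (t (Suc n) - t n)) = 2 * c * T"
    using d by (simp add: sum_distrib_left[symmetric] sum_lessThan_telescope discretizations_def)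
  finally show ?thesis .
qed

text \<open>Tonelli for an independent pair, whose joint law is the product of the marginal laws. It
  permits averaging over the path of \<open>B\<close> with the path of \<open>W\<close> held
  fixed.\<close>

lemma (in prob_space) indep_var_nn_integral_iterated:
  assumes ind: "indep_var S X R Y" and F: "F \<in> borel_measurable (S \<Otimes>\<^sub>M R)"
  shows "(\<integral>\<^sup>+\<omega>. F (X \<omega>, Y \<omega>) \<partial>M) = (\<integral>\<^sup>+\<omega>'. \<integral>\<^sup>+\<omega>. F (X \<omega>', Y \<omega>) \<partial>M \<partial>M)"
proof -
  have X[measurable]: "X \<in> M \<rightarrow>\<^sub>M S" and Y[measurable]: "Y \<in> M \<rightarrow>\<^sub>M R"
    and eq: "distr M S X \<Otimes>\<^sub>M distr M R Y = distr M (S \<Otimes>\<^sub>M R) (\<lambda>\<omega>. (X \<omega>, Y \<omega>))"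
    using ind unfolding indep_var_distribution_eq by auto
  interpret Y: prob_space "distr M R Y" by (rule prob_space_distr) simp
  note F[measurable]
  have "(\<integral>\<^sup>+\<omega>. F (X \<omega>, Y \<omega>) \<partial>M) = (\<integral>\<^sup>+z. F z \<partial>(distr M S X \<Otimes>\<^sub>M distr M R Y))"
    unfolding eq by (subst nn_integral_distr) auto
  also have "\<dots> = (\<integral>\<^sup>+x. \<integral>\<^sup>+y. F (x, y) \<partial>distr M R Y \<partial>distr M S X)"
    by (rule Y.nn_integral_fst[symmetric]) simp
  also have "\<dots> = (\<integral>\<^sup>+\<omega>'. \<integral>\<^sup>+y. F (X \<omega>', y) \<partial>distr M R Y \<partial>M)"
    by (subst nn_integral_distr) auto
  also have "\<dots> = (\<integral>\<^sup>+\<omega>'. \<integral>\<^sup>+\<omega>. F (X \<omega>', Y \<omega>) \<partial>M \<partial>M)"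
  proof (rule nn_integral_cong)
    fix \<omega>' assume \<omega>': "\<omega>' \<in> space M"
    \<comment> \<open>Membership in \<open>space S\<close> makes the section of \<open>F\<close> at
      \<open>X \<omega>'\<close> measurable.\<close>
    then have "X \<omega>' \<in> space S" using measurable_space[OF X] by auto
    then show "(\<integral>\<^sup>+y. F (X \<omega>', y) \<partial>distr M R Y) = (\<integral>\<^sup>+\<omega>. F (X \<omega>', Y \<omega>) \<partial>M)"
      by (subst nn_integral_distr) auto
  qed
  finally show ?thesis .
qed

section \<open>The scheme along fixed paths\<close>

text \<open>In contrast to \<open>heston_v_Suc\<close>, this closed form does not presuppose a
  nonnegative value, so it serves for measurability on the space of all paths.\<close>

lemma heston_v_Suc_explicit:
  assumes "\<kappa> > 0" "t n < t (Suc n)"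
  shows "heston_v \<kappa> lam \<theta> v\<^sub>0 t w (Suc n) =
    (heston_v \<kappa> lam \<theta> v\<^sub>0 t w n + \<kappa> * lam * (t (Suc n) - t n)
     + \<theta> * sqrt (heston_v \<kappa> lam \<theta> v\<^sub>0 t w n) * (w (t (Suc n)) - w (t n))
     + \<theta>\<^sup>2 / 4 * ((w (t (Suc n)) - w (t n))\<^sup>2 - (t (Suc n) - t n))) / (1 + \<kappa> * (t (Suc n) - t n))"
  using iffD1[OF implicit_step_unique[OF assms(1)] heston_v_implicit[OF assms]] assms(2)
  by (simp del: heston_v.simps)

text \<open>In \<open>heston_v_Suc\<close> the numerator is a square plus a multiple of the step,
  and \<open>\<theta>\<^sup>2 \<le> 4 * \<kappa> * lam\<close> is the sign condition on that
  multiple.\<close>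

lemma heston_v_nonneg:
  assumes "\<kappa> > 0" "v\<^sub>0 \<ge> 0" "\<theta>\<^sup>2 \<le> 4 * \<kappa> * lam" "\<And>n. n < N \<Longrightarrow> t n < t (Suc n)" "n \<le> N"
  shows "heston_v \<kappa> lam \<theta> v\<^sub>0 t w n \<ge> 0"
  using assms(5)
proof (induction n)
  case 0
  then show ?case using assms(2) by simp
next
  case (Suc n)
  then have h: "t n < t (Suc n)" and v: "heston_v \<kappa> lam \<theta> v\<^sub>0 t w n \<ge> 0"
    using assms(4) by auto
  have "(\<kappa> * lam - \<theta>\<^sup>2 / 4) * (t (Suc n) - t n) \<ge> 0"
    using h assms(3) by simp
  then show ?case
    unfolding heston_v_Suc[OF assms(1) h v] using assms(1) h by simp
qed

lemma heston_v_cong: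
  assumes "\<And>i. i \<le> n \<Longrightarrow> w (t i) = w' (t i)"
  shows "heston_v \<kappa> lam \<theta> v\<^sub>0 t w n = heston_v \<kappa> lam \<theta> v\<^sub>0 t w' n"
  using assms by (induction n) auto

text \<open>Lets a path be replaced by its restriction to \<open>{0..}\<close>, the form in which
  paths are elements of the product space used for independence.\<close>

lemma heston_x_cong:
  assumes "\<And>i. i \<le> n \<Longrightarrow> w (t i) = w' (t i)" "\<And>i. i \<le> n \<Longrightarrow> b (t i) = b' (t i)"
  shows "heston_x \<mu> \<kappa> lam \<theta> \<rho> x\<^sub>0 v\<^sub>0 t w b n = heston_x \<mu> \<kappa> lam \<theta> \<rho> x\<^sub>0 v\<^sub>0 t w' b' n"
  using assms
proof (induction n)
  case (Suc n)
  have "heston_v \<kappa> lam \<theta> v\<^sub>0 t w n = heston_v \<kappa> lam \<theta> v\<^sub>0 t w' n"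
    by (rule heston_v_cong) (use Suc.prems in auto)
  then show ?case using Suc by simp
qed simp

lemma heston_x_eq_sum:
  "heston_x \<mu> \<kappa> lam \<theta> \<rho> x\<^sub>0 v\<^sub>0 t w b n = x\<^sub>0 + \<mu> * (t n - t 0)
     + (\<Sum>i<n. - 1 / 2 * heston_v \<kappa> lam \<theta> v\<^sub>0 t w i * (t (Suc i) - t i))
     + \<rho> * (\<Sum>i<n. sqrt (heston_v \<kappa> lam \<theta> v\<^sub>0 t w i) * (w (t (Suc i)) - w (t i)))
     + (\<Sum>i<n. sqrt (1 - \<rho>\<^sup>2) * sqrt (heston_v \<kappa> lam \<theta> v\<^sub>0 t w i) * (b (t (Suc i)) - b (t i)))"
  by (induction n) (simp_all add: algebra_simps del: heston_v.simps)

text \<open>As a function on path space, the value depends on finitely many coordinates only, all at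
  nonnegative times.\<close>

lemma heston_v_measurable:
  assumes "\<kappa> > 0" "(N, t) \<in> discretizations T" "n \<le> N"
  shows "(\<lambda>w. heston_v \<kappa> lam \<theta> v\<^sub>0 t w n) \<in> borel_measurable (PiM {0..} (\<lambda>_. borel))"
  using assms(3)
proof (induction n)
  case (Suc n)
  have h: "t n < t (Suc n)" and "t n \<in> {0..}" "t (Suc n) \<in> {0..}"
    using assms(2) Suc.prems discretizations_nonneg[OF assms(2)] by (auto simp: discretizations_def)
  then have [measurable]: "(\<lambda>w. w (t n)) \<in> borel_measurable (PiM {0..} (\<lambda>_. borel :: real measure))"
      "(\<lambda>w. w (t (Suc n))) \<in> borel_measurable (PiM {0..} (\<lambda>_. borel :: real measure))"
    by (auto intro: measurable_component_singleton)
  have [measurable]: "(\<lambda>w. heston_v \<kappa> lam \<theta> v\<^sub>0 t w n) \<in> borel_measurable (PiM {0..} (\<lambda>_. borel))"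
    using Suc by simp
  show ?case
    unfolding heston_v_Suc_explicit[of \<kappa> t n, OF assms(1) h] by measurable
qed simp

lemma heston_x_measurable:
  assumes "\<kappa> > 0" "(N, t) \<in> discretizations T" "n \<le> N"
  shows "(\<lambda>z. heston_x \<mu> \<kappa> lam \<theta> \<rho> x\<^sub>0 v\<^sub>0 t (fst z) (snd z) n)
    \<in> borel_measurable (PiM {0..} (\<lambda>_. borel) \<Otimes>\<^sub>M PiM {0..} (\<lambda>_. borel))"
  using assms(3)
proof (induction n)
  case (Suc n)
  have "t n \<in> {0..}" "t (Suc n) \<in> {0..}"
    using Suc.prems discretizations_nonneg[OF assms(2)] by auto
  then have [measurable]: "(\<lambda>w. w (t n)) \<in> borel_measurable (PiM {0..} (\<lambda>_. borel :: real measure))"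
      "(\<lambda>w. w (t (Suc n))) \<in> borel_measurable (PiM {0..} (\<lambda>_. borel :: real measure))"
    by (auto intro: measurable_component_singleton)
  have [measurable]: "(\<lambda>w. heston_v \<kappa> lam \<theta> v\<^sub>0 t w n) \<in> borel_measurable (PiM {0..} (\<lambda>_. borel))"
    using heston_v_measurable[OF assms(1,2)] Suc.prems by simp
  have [measurable]: "(\<lambda>z. heston_x \<mu> \<kappa> lam \<theta> \<rho> x\<^sub>0 v\<^sub>0 t (fst z) (snd z) n)
    \<in> borel_measurable (PiM {0..} (\<lambda>_. borel) \<Otimes>\<^sub>M PiM {0..} (\<lambda>_. borel))"
    using Suc by simp
  show ?case
    unfolding heston_x.simps by measurable
qed simp

text \<open>Solve the implicit recursion for the stochastic term, discard the nonnegative terms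
  \<open>\<kappa> * v (Suc n) * h\<close> and \<open>\<theta>\<^sup>2 / 4 * h\<close>, and sum: the
  increments of \<open>v\<close> telescope.\<close>

lemma heston_stochastic_sum_ge:
  assumes "\<kappa> > 0" "v\<^sub>0 \<ge> 0" "\<theta>\<^sup>2 \<le> 4 * \<kappa> * lam" and d: "(N, t) \<in> discretizations T"
  shows "\<theta> * (\<Sum>n<N. sqrt (heston_v \<kappa> lam \<theta> v\<^sub>0 t w n) * (w (t (Suc n)) - w (t n)))
    \<ge> - v\<^sub>0 - \<kappa> * lam * T - \<theta>\<^sup>2 / 4 * (\<Sum>n<N. (w (t (Suc n)) - w (t n))\<^sup>2)"
proof -
  let ?v = "heston_v \<kappa> lam \<theta> v\<^sub>0 t w"
  have t: "\<And>n. n < N \<Longrightarrow> t n < t (Suc n)" "t 0 = 0" "t N = T"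
    using d by (auto simp: discretizations_def)
  have nonneg: "?v n \<ge> 0" if "n \<le> N" for n
    using heston_v_nonneg[where N = N] assms t(1) that by blast
  have "(\<Sum>n<N. (?v (Suc n) - ?v n) - \<kappa> * lam * (t (Suc n) - t n)
      - \<theta>\<^sup>2 / 4 * (w (t (Suc n)) - w (t n))\<^sup>2)
    \<le> (\<Sum>n<N. \<theta> * (sqrt (?v n) * (w (t (Suc n)) - w (t n))))"
  proof (rule sum_mono)
    fix n assume "n \<in> {..<N}"
    then have h: "t n < t (Suc n)" and v: "?v (Suc n) \<ge> 0"
      using t(1) nonneg[of "Suc n"] by auto
    have "\<kappa> * ?v (Suc n) * (t (Suc n) - t n) \<ge> 0" "\<theta>\<^sup>2 / 4 * (t (Suc n) - t n) \<ge> 0"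
      using h v assms(1) by (auto simp del: heston_v.simps)
    then show "(?v (Suc n) - ?v n) - \<kappa> * lam * (t (Suc n) - t n)
        - \<theta>\<^sup>2 / 4 * (w (t (Suc n)) - w (t n))\<^sup>2
        \<le> \<theta> * (sqrt (?v n) * (w (t (Suc n)) - w (t n)))"
      using heston_v_implicit[where t = t and n = n, OF assms(1) h, of lam \<theta> v\<^sub>0 w]
      by (simp add: algebra_simps del: heston_v.simps)
  qed
  also have "\<dots> = \<theta> * (\<Sum>n<N. sqrt (?v n) * (w (t (Suc n)) - w (t n)))"
    by (simp add: sum_distrib_left)
  also have "(\<Sum>n<N. (?v (Suc n) - ?v n) - \<kappa> * lam * (t (Suc n) - t n)
      - \<theta>\<^sup>2 / 4 * (w (t (Suc n)) - w (t n))\<^sup>2)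
    = (?v N - v\<^sub>0) - \<kappa> * lam * T - \<theta>\<^sup>2 / 4 * (\<Sum>n<N. (w (t (Suc n)) - w (t n))\<^sup>2)"
  proof -
    have "(\<Sum>n<N. \<kappa> * lam * (t (Suc n) - t n)) = \<kappa> * lam * T"
      by (simp only: sum_distrib_left[symmetric] sum_lessThan_telescope t(2,3)) simp
    then show ?thesis
      by (subst sum_subtractf, subst sum_subtractf)
        (simp only: sum_lessThan_telescope sum_distrib_left[symmetric] heston_v.simps(1))
  qed
  \<comment> \<open>The terminal value enters the lower bound with a positive sign and is dropped,
    as \<open>?v N \<ge> 0\<close>.\<close>
  finally show ?thesis
    using nonneg[of N] by simp
qed

section \<open>Exponential moments of the scheme\<close>

lemma (in prob_space) heston_x_random_variable:
  assumes W: "standard_brownian_motion W" and B: "standard_brownian_motion B"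
    and \<kappa>: "\<kappa> > 0" and d: "(N, t) \<in> discretizations T"
  shows "(\<lambda>\<omega>. heston_x \<mu> \<kappa> lam \<theta> \<rho> x\<^sub>0 v\<^sub>0 t (\<lambda>s. W s \<omega>) (\<lambda>s. B s \<omega>) N) \<in> borel_measurable M"
proof -
  have path: "(\<lambda>\<omega>. \<lambda>s\<in>{0..}. Z s \<omega>) \<in> M \<rightarrow>\<^sub>M PiM {0..} (\<lambda>_. borel)"
    if "standard_brownian_motion Z" for Z
    using that unfolding standard_brownian_motion_def by (intro measurable_restrict) auto
  have "(\<lambda>\<omega>. heston_x \<mu> \<kappa> lam \<theta> \<rho> x\<^sub>0 v\<^sub>0 t (\<lambda>s\<in>{0..}. W s \<omega>) (\<lambda>s\<in>{0..}. B s \<omega>) N) \<in> borel_measurable M"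
    using measurable_compose[OF measurable_Pair[OF path[OF W] path[OF B]]
        heston_x_measurable[OF \<kappa> d order_refl]] by simp
  moreover have "heston_x \<mu> \<kappa> lam \<theta> \<rho> x\<^sub>0 v\<^sub>0 t (\<lambda>s\<in>{0..}. W s \<omega>) (\<lambda>s\<in>{0..}. B s \<omega>) N
      = heston_x \<mu> \<kappa> lam \<theta> \<rho> x\<^sub>0 v\<^sub>0 t (\<lambda>s. W s \<omega>) (\<lambda>s. B s \<omega>) N" for \<omega>
    by (rule heston_x_cong) (use discretizations_nonneg[OF d] in auto)
  ultimately show ?thesis
    by simp
qed

text \<open>With \<open>w\<close> fixed the values \<open>v n\<close> are deterministic, so the
  \<open>B\<close>-part is a sum of independent Gaussians; its moment contributes the coefficient
  \<open>p\<^sup>2 * (1 - \<rho>\<^sup>2) / 2\<close> that joins the \<open>- p / 2\<close> of the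
  drift.\<close>

lemma (in prob_space) nn_integral_exp_heston_x_fixed_path:
  fixes w :: "real \<Rightarrow> real"
  assumes B: "standard_brownian_motion B" and d: "(N, t) \<in> discretizations T"
    and "\<kappa> > 0" "v\<^sub>0 \<ge> 0" "\<theta>\<^sup>2 \<le> 4 * \<kappa> * lam" "\<rho>\<^sup>2 \<le> 1"
  defines "v \<equiv> heston_v \<kappa> lam \<theta> v\<^sub>0 t w"
  shows "(\<integral>\<^sup>+\<omega>. ennreal (exp (p * heston_x \<mu> \<kappa> lam \<theta> \<rho> x\<^sub>0 v\<^sub>0 t w (\<lambda>s. B s \<omega>) N)) \<partial>M)
    = ennreal (exp (p * x\<^sub>0 + p * \<mu> * T
        + (p\<^sup>2 * (1 - \<rho>\<^sup>2) - p) / 2 * (\<Sum>n<N. v n * (t (Suc n) - t n))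
        + p * \<rho> * (\<Sum>n<N. sqrt (v n) * (w (t (Suc n)) - w (t n)))))"
proof -
  have t: "\<And>n. n < N \<Longrightarrow> t n < t (Suc n)" "t 0 = 0" "t N = T"
    using d by (auto simp: discretizations_def)
  have nonneg: "v n \<ge> 0" if "n \<le> N" for n
    unfolding v_def using heston_v_nonneg[where N = N] assms(3-5) t(1) that by blast
  \<comment> \<open>\<open>C\<close> collects everything that does not involve \<open>B\<close>;
    \<open>a n\<close> is the deterministic coefficient of the increment of \<open>B\<close> over
    step \<open>n\<close>.\<close>
  define C where "C = p * x\<^sub>0 + p * \<mu> * T - p / 2 * (\<Sum>n<N. v n * (t (Suc n) - t n))
    + p * \<rho> * (\<Sum>n<N. sqrt (v n) * (w (t (Suc n)) - w (t n)))"
  define a where "a = (\<lambda>n. p * sqrt (1 - \<rho>\<^sup>2) * sqrt (v n))"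
  have [measurable]: "(\<lambda>\<omega>. B (t n) \<omega>) \<in> borel_measurable M" if "n \<le> N" for n
    using B discretizations_nonneg[OF d that] unfolding standard_brownian_motion_def by auto
  have "p * heston_x \<mu> \<kappa> lam \<theta> \<rho> x\<^sub>0 v\<^sub>0 t w b N = C + (\<Sum>n<N. a n * (b (t (Suc n)) - b (t n)))" for b
    unfolding heston_x_eq_sum C_def a_def t(2,3) v_def[symmetric]
    by (simp add: algebra_simps sum_distrib_left sum_negf sum_divide_distrib diff_divide_distrib sum_subtractf)
  then have "(\<integral>\<^sup>+\<omega>. ennreal (exp (p * heston_x \<mu> \<kappa> lam \<theta> \<rho> x\<^sub>0 v\<^sub>0 t w (\<lambda>s. B s \<omega>) N)) \<partial>M)
      = (\<integral>\<^sup>+\<omega>. ennreal (exp C) * ennreal (exp (\<Sum>n<N. a n * (B (t (Suc n)) \<omega> - B (t n) \<omega>))) \<partial>M)"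
    by (simp add: exp_add ennreal_mult')
  also have "\<dots> = ennreal (exp C) * (\<integral>\<^sup>+\<omega>. ennreal (exp (\<Sum>n<N. a n * (B (t (Suc n)) \<omega> - B (t n) \<omega>))) \<partial>M)"
    by (rule nn_integral_cmult) measurable
  also have "\<dots> = ennreal (exp C) * ennreal (exp (\<Sum>n<N. (a n)\<^sup>2 * (t (Suc n) - t n) / 2))"
    by (simp add: nn_integral_exp_sum_increments[OF B d])
  \<comment> \<open>Nonnegativity of \<open>v n\<close> and of \<open>1 - \<rho>\<^sup>2\<close>
    lets the squares cancel the square roots in \<open>a n\<close>.\<close>
  also have "(\<Sum>n<N. (a n)\<^sup>2 * (t (Suc n) - t n) / 2)
      = p\<^sup>2 * (1 - \<rho>\<^sup>2) / 2 * (\<Sum>n<N. v n * (t (Suc n) - t n))"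
    unfolding sum_distrib_left a_def
    by (rule sum.cong) (use nonneg assms(6) in \<open>auto simp: power_mult_distrib\<close>)
  finally show ?thesis
    unfolding C_def ennreal_mult'[OF exp_ge_zero, symmetric] exp_add[symmetric]
    by (simp add: algebra_simps diff_divide_distrib)
qed

text \<open>Averaging over \<open>B\<close> for each path of \<open>W\<close> and dropping the
  nonpositive multiple of the sum of \<open>v n * h\<close> leaves an exponential moment of the
  squared increments of \<open>W\<close>. The resulting bound depends on neither \<open>N\<close>
  nor the intermediate times.\<close>

lemma (in prob_space) nn_integral_exp_heston_x_le:
  assumes W: "standard_brownian_motion W" and B: "standard_brownian_motion B"
    and ind: "indep_processes W B" and d: "(N, t) \<in> discretizations T"
    and \<kappa>: "\<kappa> > 0" and v\<^sub>0: "v\<^sub>0 \<ge> 0" and \<theta>: "\<theta> > 0" "\<theta>\<^sup>2 \<le> 4 * \<kappa> * lam"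
    and \<rho>: "\<rho>\<^sup>2 \<le> 1" "\<rho> \<le> 0" and p: "p \<ge> 0" "p * (1 - \<rho>\<^sup>2) \<le> 1"
    and fine: "- p * \<rho> * \<theta> * mesh (N, t) \<le> 1"
  shows "(\<integral>\<^sup>+\<omega>. ennreal (exp (p * heston_x \<mu> \<kappa> lam \<theta> \<rho> x\<^sub>0 v\<^sub>0 t (\<lambda>s. W s \<omega>) (\<lambda>s. B s \<omega>) N)) \<partial>M)
    \<le> ennreal (exp (p * x\<^sub>0 + p * \<mu> * T - p * \<rho> / \<theta> * (v\<^sub>0 + \<kappa> * lam * T) - p * \<rho> * \<theta> / 2 * T))"
proof -
  \<comment> \<open>\<open>c\<close> is the factor of the squared increments once the term
    \<open>- \<theta>\<^sup>2 / 4\<close> of the pathwise estimate is multiplied by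
    \<open>p * \<rho> / \<theta>\<close>.\<close>
  define c where "c = - p * \<rho> * \<theta> / 4"
  define K where "K = p * x\<^sub>0 + p * \<mu> * T - p * \<rho> / \<theta> * (v\<^sub>0 + \<kappa> * lam * T)"
  have p\<rho>: "p * \<rho> \<le> 0"
    using p \<rho> by (simp add: mult_nonneg_nonpos)
  have c: "c \<ge> 0"
    using p\<rho> \<theta>(1) by (simp add: c_def mult_nonpos_nonneg)
  have t: "\<And>n. n < N \<Longrightarrow> t n < t (Suc n)"
    using d by (auto simp: discretizations_def)
  have [measurable]: "(\<lambda>\<omega>. W (t n) \<omega>) \<in> borel_measurable M" if "n \<le> N" for n
    using W discretizations_nonneg[OF d that] unfolding standard_brownian_motion_def by auto
  define X where "X = (\<lambda>w b. heston_x \<mu> \<kappa> lam \<theta> \<rho> x\<^sub>0 v\<^sub>0 t w b N)"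
  have restr: "X (\<lambda>s\<in>{0..}. W s \<omega>') (\<lambda>s\<in>{0..}. B s \<omega>) = X (\<lambda>s. W s \<omega>') (\<lambda>s. B s \<omega>)" for \<omega> \<omega>'
    unfolding X_def by (rule heston_x_cong) (use discretizations_nonneg[OF d] in auto)
  have [measurable]: "(\<lambda>z. X (fst z) (snd z))
    \<in> borel_measurable (PiM {0..} (\<lambda>_. borel) \<Otimes>\<^sub>M PiM {0..} (\<lambda>_. borel))"
    unfolding X_def by (rule heston_x_measurable[OF \<kappa> d]) simp
  have "(\<integral>\<^sup>+\<omega>. ennreal (exp (p * X (\<lambda>s. W s \<omega>) (\<lambda>s. B s \<omega>))) \<partial>M)
      = (\<integral>\<^sup>+\<omega>'. \<integral>\<^sup>+\<omega>. ennreal (exp (p * X (\<lambda>s. W s \<omega>') (\<lambda>s. B s \<omega>))) \<partial>M \<partial>M)"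
    using indep_var_nn_integral_iterated[OF ind[unfolded indep_processes_def],
        of "\<lambda>z. ennreal (exp (p * X (fst z) (snd z)))"]
    by (simp add: restr)
  also have "\<dots> \<le> (\<integral>\<^sup>+\<omega>. ennreal (exp K) * ennreal (exp (\<Sum>n<N. c * (W (t (Suc n)) \<omega> - W (t n) \<omega>)\<^sup>2)) \<partial>M)"
  proof (rule nn_integral_mono)
    fix \<omega>'
    define w where "w = (\<lambda>s. W s \<omega>')"
    define v where "v = heston_v \<kappa> lam \<theta> v\<^sub>0 t w"
    define S where "S = (\<Sum>n<N. sqrt (v n) * (w (t (Suc n)) - w (t n)))"
    define Q where "Q = (\<Sum>n<N. (w (t (Suc n)) - w (t n))\<^sup>2)"
    have nonneg: "v n \<ge> 0" if "n \<le> N" for n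
      unfolding v_def using heston_v_nonneg[where N = N] \<kappa> v\<^sub>0 \<theta> t that by blast
    \<comment> \<open>Factoring out \<open>p\<close> reduces the sign of the coefficient to
      \<open>p * (1 - \<rho>\<^sup>2) \<le> 1\<close>.\<close>
    have "p\<^sup>2 * (1 - \<rho>\<^sup>2) - p = p * (p * (1 - \<rho>\<^sup>2) - 1)"
      by (simp add: power2_eq_square algebra_simps)
    then have "p\<^sup>2 * (1 - \<rho>\<^sup>2) - p \<le> 0"
      using p by (simp add: mult_nonneg_nonpos)
    moreover have "(\<Sum>n<N. v n * (t (Suc n) - t n)) \<ge> 0"
      using nonneg t by (intro sum_nonneg mult_nonneg_nonneg) (auto simp: less_imp_le)
    ultimately have 1: "(p\<^sup>2 * (1 - \<rho>\<^sup>2) - p) / 2 * (\<Sum>n<N. v n * (t (Suc n) - t n)) \<le> 0"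
      by (intro mult_nonpos_nonneg) auto
    \<comment> \<open>Multiplication by \<open>p * \<rho> / \<theta> \<le> 0\<close> reverses the
      lower bound on the stochastic sum; the sign of \<open>\<rho>\<close> is decisive here.\<close>
    have "p * \<rho> / \<theta> * (\<theta> * S) \<le> p * \<rho> / \<theta> * (- v\<^sub>0 - \<kappa> * lam * T - \<theta>\<^sup>2 / 4 * Q)"
      unfolding S_def Q_def v_def
      using heston_stochastic_sum_ge[OF \<kappa> v\<^sub>0 \<theta>(2) d, of w] p\<rho> \<theta>(1)
      by (intro mult_left_mono_neg) (auto simp: divide_nonpos_pos)
    also have "\<dots> = - p * \<rho> / \<theta> * (v\<^sub>0 + \<kappa> * lam * T) + c * Q"
      using \<theta>(1) by (simp add: c_def field_simps power2_eq_square)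
    finally have 2: "p * \<rho> * S \<le> - p * \<rho> / \<theta> * (v\<^sub>0 + \<kappa> * lam * T) + c * Q"
      using \<theta>(1) by simp
    have "(\<integral>\<^sup>+\<omega>. ennreal (exp (p * X w (\<lambda>s. B s \<omega>))) \<partial>M)
        = ennreal (exp (p * x\<^sub>0 + p * \<mu> * T
            + (p\<^sup>2 * (1 - \<rho>\<^sup>2) - p) / 2 * (\<Sum>n<N. v n * (t (Suc n) - t n)) + p * \<rho> * S))"
      unfolding X_def S_def v_def
      by (rule nn_integral_exp_heston_x_fixed_path[OF B d \<kappa> v\<^sub>0 \<theta>(2) \<rho>(1)])
    also have "\<dots> \<le> ennreal (exp (K + c * Q))"
      using 1 2 by (intro ennreal_leI) (simp add: K_def)
    also have "\<dots> = ennreal (exp K) * ennreal (exp (\<Sum>n<N. c * (w (t (Suc n)) - w (t n))\<^sup>2))"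
      by (simp add: exp_add ennreal_mult' Q_def sum_distrib_left)
    finally show "(\<integral>\<^sup>+\<omega>. ennreal (exp (p * X (\<lambda>s. W s \<omega>') (\<lambda>s. B s \<omega>))) \<partial>M)
        \<le> ennreal (exp K) * ennreal (exp (\<Sum>n<N. c * (W (t (Suc n)) \<omega>' - W (t n) \<omega>')\<^sup>2))"
      by (simp add: w_def)
  qed
  also have "\<dots> = ennreal (exp K) * (\<integral>\<^sup>+\<omega>. ennreal (exp (\<Sum>n<N. c * (W (t (Suc n)) \<omega> - W (t n) \<omega>)\<^sup>2)) \<partial>M)"
    by (rule nn_integral_cmult) measurable
  \<comment> \<open>For the chosen \<open>c\<close>, \<open>fine\<close> is the condition
    \<open>4 * c * mesh (N, t) \<le> 1\<close>.\<close>
  also have "\<dots> \<le> ennreal (exp K) * ennreal (exp (2 * c * T))"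
    using fine c by (intro mult_left_mono nn_integral_exp_sum_squared_increments_le[OF W d])
      (auto simp: c_def)
  also have "\<dots> = ennreal (exp (K + 2 * c * T))"
    by (simp add: exp_add ennreal_mult')
  also have "K + 2 * c * T = p * x\<^sub>0 + p * \<mu> * T - p * \<rho> / \<theta> * (v\<^sub>0 + \<kappa> * lam * T) - p * \<rho> * \<theta> / 2 * T"
    by (simp add: K_def c_def)
  finally show ?thesis
    by (simp only: X_def)
qed

section \<open>From exponential moments to \<open>f\<close> and to vanishing mesh\<close>

theorem proposition1p3:
  fixes M :: "'a measure" and W B :: "real \<Rightarrow> 'a \<Rightarrow> real"
    and T x\<^sub>0 v\<^sub>0 \<kappa> lam \<theta> \<mu> \<rho> \<nu> :: real
    and f :: "real \<Rightarrow> real"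
  assumes "prob_space M"
    and "prob_space.standard_brownian_motion M W"
    and "prob_space.standard_brownian_motion M B"
    and "prob_space.indep_processes M W B"
    and "T > 0" and "v\<^sub>0 > 0" and "\<kappa> > 0" and "lam > 0" and "\<theta> > 0"
    and "\<rho> \<in> {-1..1}"
    and "\<nu> = 2 * \<kappa> * lam / \<theta>\<^sup>2" and "\<nu> > 1 / 2"
    and "f \<in> borel_measurable borel"
    and "bdd_above (range (\<lambda>x. \<bar>f x * exp (- x)\<bar>))"
    and "\<rho> < 0"
  shows "\<exists>\<epsilon>>0. Limsup (mesh_to_0 T) (\<lambda>(N, t).
           \<integral>\<^sup>+\<omega>. ennreal (\<bar>f (heston_x \<mu> \<kappa> lam \<theta> \<rho> x\<^sub>0 v\<^sub>0 t (\<lambda>s. W s \<omega>) (\<lambda>s. B s \<omega>) N)\<bar> powr (1 + \<epsilon>)) \<partial>M)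
         < \<infinity>"
proof -
  interpret prob_space M by fact
  \<comment> \<open>The witness is \<open>\<epsilon> = \<rho>\<^sup>2\<close>, positive because
    \<open>\<rho> < 0\<close>; here
    \<open>p * (1 - \<rho>\<^sup>2) = 1 - \<rho>\<^sup>4\<close>.\<close>
  define p where "p = 1 + \<rho>\<^sup>2"
  have \<rho>: "\<rho>\<^sup>2 > 0" "\<rho>\<^sup>2 \<le> 1"
    using assms(10,15) by (auto simp: abs_square_le_1)
  have p: "p > 0" "p * (1 - \<rho>\<^sup>2) \<le> 1"
    using \<rho> by (auto simp: p_def algebra_simps intro: add_pos_nonneg)
  \<comment> \<open>\<open>\<nu> > 1 / 2\<close> amounts to
    \<open>\<theta>\<^sup>2 < 4 * \<kappa> * lam\<close>, which keeps \<open>v\<close>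
    nonnegative.\<close>
  have \<theta>: "\<theta>\<^sup>2 \<le> 4 * \<kappa> * lam"
    using assms(12) zero_less_power[OF assms(9), of 2] unfolding assms(11)
    by (simp add: pos_less_divide_eq)
  obtain C where C: "\<And>x. \<bar>f x * exp (- x)\<bar> \<le> C"
    using assms(14) by (auto simp: bdd_above_def)
  have C0: "C \<ge> 0"
    using C[of 0] abs_ge_zero order_trans by blast
  \<comment> \<open>The growth hypothesis on \<open>f\<close> reduces the moment of order
    \<open>p\<close> to an exponential moment of the terminal value.\<close>
  have f: "\<bar>f x\<bar> powr p \<le> C powr p * exp (p * x)" for x
  proof -
    have "\<bar>f x\<bar> \<le> C * exp x"
      using C[of x] by (simp add: abs_mult exp_minus field_simps)
    then have "\<bar>f x\<bar> powr p \<le> (C * exp x) powr p"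
      using p(1) by (intro powr_mono2) auto
    also have "\<dots> = C powr p * exp (p * x)"
      using C0 by (simp add: powr_mult exp_powr_real mult.commute)
    finally show ?thesis .
  qed
  define K where
    "K = p * x\<^sub>0 + p * \<mu> * T - p * \<rho> / \<theta> * (v\<^sub>0 + \<kappa> * lam * T) - p * \<rho> * \<theta> / 2 * T"
  \<comment> \<open>Chosen so that \<open>mesh (N, t) < \<delta>\<close> yields the mesh condition
    of \<open>nn_integral_exp_heston_x_le\<close>.\<close>
  define \<delta> where "\<delta> = 1 / (- p * \<rho> * \<theta>)"
  have p\<rho>\<theta>: "- p * \<rho> * \<theta> > 0"
    using p(1) assms(9,15) by (simp add: mult_pos_neg mult_neg_pos)
  have bound: "(\<integral>\<^sup>+\<omega>. ennreal (\<bar>f (heston_x \<mu> \<kappa> lam \<theta> \<rho> x\<^sub>0 v\<^sub>0 t (\<lambda>s. W s \<omega>) (\<lambda>s. B s \<omega>) N)\<bar> powr p) \<partial>M)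
      \<le> ennreal (C powr p) * ennreal (exp K)"
    if d: "(N, t) \<in> discretizations T" and "mesh (N, t) < \<delta>" for N t
  proof -
    define X where "X = (\<lambda>\<omega>. heston_x \<mu> \<kappa> lam \<theta> \<rho> x\<^sub>0 v\<^sub>0 t (\<lambda>s. W s \<omega>) (\<lambda>s. B s \<omega>) N)"
    have [measurable]: "X \<in> borel_measurable M"
      unfolding X_def by (rule heston_x_random_variable) (use assms d in auto)
    have "mesh (N, t) * (- p * \<rho> * \<theta>) < 1"
      using that(2) p\<rho>\<theta> unfolding \<delta>_def by (simp only: pos_less_divide_eq)
    then have fine: "- p * \<rho> * \<theta> * mesh (N, t) \<le> 1"
      by (simp add: mult.commute)
    have "(\<integral>\<^sup>+\<omega>. ennreal (\<bar>f (X \<omega>)\<bar> powr p) \<partial>M)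
        \<le> (\<integral>\<^sup>+\<omega>. ennreal (C powr p) * ennreal (exp (p * X \<omega>)) \<partial>M)"
      using f by (intro nn_integral_mono) (simp add: ennreal_mult'[symmetric] ennreal_leI)
    also have "\<dots> = ennreal (C powr p) * (\<integral>\<^sup>+\<omega>. ennreal (exp (p * X \<omega>)) \<partial>M)"
      by (rule nn_integral_cmult) measurable
    also have "(\<integral>\<^sup>+\<omega>. ennreal (exp (p * X \<omega>)) \<partial>M) \<le> ennreal (exp K)"
      unfolding X_def K_def
      using assms \<rho> \<theta> p fine d by (intro nn_integral_exp_heston_x_le) auto
    finally show ?thesis
      unfolding X_def by (simp add: mult_left_mono)
  qed
  \<comment> \<open>The bound is the same for all discretizations finer than
    \<open>\<delta>\<close>, hence holds eventually along the filter and passes to the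
    limsup.\<close>
  have "Limsup (mesh_to_0 T) (\<lambda>(N, t).
      \<integral>\<^sup>+\<omega>. ennreal (\<bar>f (heston_x \<mu> \<kappa> lam \<theta> \<rho> x\<^sub>0 v\<^sub>0 t (\<lambda>s. W s \<omega>) (\<lambda>s. B s \<omega>) N)\<bar> powr p) \<partial>M)
      \<le> ennreal (C powr p) * ennreal (exp K)"
  proof (rule Limsup_bounded)
    have "\<delta> > 0"
      using p\<rho>\<theta> by (simp only: \<delta>_def zero_less_divide_1_iff)
    then show "\<forall>\<^sub>F d in mesh_to_0 T. (case d of (N, t) \<Rightarrow>
      \<integral>\<^sup>+\<omega>. ennreal (\<bar>f (heston_x \<mu> \<kappa> lam \<theta> \<rho> x\<^sub>0 v\<^sub>0 t (\<lambda>s. W s \<omega>) (\<lambda>s. B s \<omega>) N)\<bar> powr p) \<partial>M)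
      \<le> ennreal (C powr p) * ennreal (exp K)"
      unfolding eventually_mesh_to_0[OF assms(5)] using bound by auto
  qed
  also have "\<dots> < \<infinity>"
    by (simp add: ennreal_mult_less_top)
  finally show ?thesis
    using \<rho>(1) unfolding p_def by blast
qed

end
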